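(* Every nonadaptive, 1-sided error $\varepsilon$-tester for connectedness of images must query $\Omega\!\left(\frac1\varepsilon\log\frac1\varepsilon\right)$ pixels (on some family of images).
   Context: An $N\times N$ image is a binary matrix $M$ indexed by $\{0,\dots,N-1\}^2$, where $1$ means black and $0$ means white. The image graph $G_M$ has as vertices the black pixels, with an edge between $(i,j)$ and $(i',j')$ iff $|i-i'|+|j-j'|=1$. $M$ is connected if $G_M$ is connected. $M$ is $\varepsilon$-far from connected if at least $\varepsilon N^2$ pixels must be changed to obtain a connected image. A 1-sided error $\varepsilon$-tester for connectedness, given query access to $M$, accepts every connected image with probability 1 and rejects every image that is $\varepsilon$-far from connected with probability at least $2/3$. It is nonadaptive if it chooses all its queries before receiving any answers. *)

theory Defs
  imports "HOL-Probability.Probability"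
begin

type_synonym pixel = "nat \<times> nat"

text \<open>Images are binary matrices with \<open>True\<close> for black (1) and \<open>False\<close> for white (0).\<close>
type_synonym image = "pixel \<Rightarrow> bool"

definition pixels :: "nat \<Rightarrow> pixel set" where
  "pixels N = {..<N} \<times> {..<N}"

definition images :: "nat \<Rightarrow> image set" where
  "images N = pixels N \<rightarrow>\<^sub>E UNIV"

definition black_pixels :: "nat \<Rightarrow> image \<Rightarrow> pixel set" where
  "black_pixels N M = {p \<in> pixels N. M p}"

definition image_edges :: "nat \<Rightarrow> image \<Rightarrow> (pixel \<times> pixel) set" where
  "image_edges N M =
     {((i, j), (i', j')) | i j i' j'.
        (i, j) \<in> black_pixels N M \<and> (i', j') \<in> black_pixels N M \<and>
        \<bar>int i - int i'\<bar> + \<bar>int j - int j'\<bar> = 1}"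

text \<open>Any two black pixels are joined by a path in the image graph.  The all-white image, whose
  graph has no vertices, counts as connected.\<close>
definition connected_image :: "nat \<Rightarrow> image \<Rightarrow> bool" where
  "connected_image N M \<longleftrightarrow>
     (\<forall>p \<in> black_pixels N M. \<forall>q \<in> black_pixels N M. (p, q) \<in> (image_edges N M)\<^sup>*)"

definition far_from_connected :: "nat \<Rightarrow> real \<Rightarrow> image \<Rightarrow> bool" where
  "far_from_connected N \<epsilon> M \<longleftrightarrow>
     (\<forall>M' \<in> images N. connected_image N M' \<longrightarrow>
        real (card {p \<in> pixels N. M p \<noteq> M' p}) \<ge> \<epsilon> * (real N)\<^sup>2)"

text \<open>A randomized nonadaptive algorithm is a distribution over deterministic ones.  A deterministic
  nonadaptive algorithm is a set of queried pixels, fixed in advance, together with a decision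
  (\<open>True\<close> means accept) that is a function of the answers, i.e. of the restriction of the image to
  the queried pixels.\<close>
type_synonym nonadaptive_algorithm = "(pixel set \<times> ((pixel \<Rightarrow> bool) \<Rightarrow> bool)) pmf"

definition queries_within :: "nat \<Rightarrow> nonadaptive_algorithm \<Rightarrow> bool" where
  "queries_within N T \<longleftrightarrow> (\<forall>(Q, D) \<in> set_pmf T. Q \<subseteq> pixels N)"

definition accept_prob :: "nonadaptive_algorithm \<Rightarrow> image \<Rightarrow> real" where
  "accept_prob T M = measure_pmf.prob T {(Q, D). D (restrict M Q)}"

definition reject_prob :: "nonadaptive_algorithm \<Rightarrow> image \<Rightarrow> real" where
  "reject_prob T M = measure_pmf.prob T {(Q, D). \<not> D (restrict M Q)}"

definition one_sided_nonadaptive_tester :: "nat \<Rightarrow> real \<Rightarrow> nonadaptive_algorithm \<Rightarrow> bool" where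
  "one_sided_nonadaptive_tester N \<epsilon> T \<longleftrightarrow>
     queries_within N T \<and>
     (\<forall>M \<in> images N. connected_image N M \<longrightarrow> accept_prob T M = 1) \<and>
     (\<forall>M \<in> images N. far_from_connected N \<epsilon> M \<longrightarrow> reject_prob T M \<ge> 2 / 3)"

text \<open>Worst case over the random choices.  The maximum exists if \<^term>\<open>queries_within N T\<close>, since then
  all the cardinalities are at most \<open>N\<^sup>2\<close>.\<close>
definition query_complexity :: "nonadaptive_algorithm \<Rightarrow> nat" where
  "query_complexity T = Max ((\<lambda>(Q, D). card Q) ` set_pmf T)"

end

theory Submission
  imports Defs
begin

text \<open>
  Let \<open>2\<^sup>K\<close> be of order \<open>1/\<epsilon>\<close> and cut the image into vertical strips of width \<open>2\<^sup>K\<close>.  A hard image of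
  level \<open>i\<close> fills a \<open>2\<^sup>-\<^sup>i\<close> fraction of the strips (a residue class modulo \<open>2\<^sup>i\<close>) with isolated black
  horizontal segments of length about \<open>2\<^sup>K\<^sup>-\<^sup>i\<close>; everything else is black.  At every level there
  are of order \<open>\<epsilon>N\<^sup>2\<close> segments, so the image is far from connected.  One unqueried pixel directly
  above each segment suffices to connect the image consistently with the answers, so a 1-sided tester
  can only reject if it has queried about \<open>2\<^sup>K\<^sup>-\<^sup>i\<close> pixels in one of the filled strips.  If a strip
  receives \<open>q\<close> queries, this is possible only at the levels with \<open>2\<^sup>-\<^sup>i \<le> 2q/2\<^sup>K\<close>, and the fraction of
  the images of level \<open>i\<close> in which the strip is filled is \<open>2\<^sup>-\<^sup>i\<close>.  Summed over these levels the strip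
  contributes a geometric series of size \<open>O(\<epsilon>q)\<close>, so the average rejection probabilities of the
  \<open>K - 1\<close> levels add up to at most \<open>O(\<epsilon>)\<close> times the number of queries, while each of them has to be at
  least \<open>2/3\<close>.
\<close>

section \<open>Counting and sums\<close>

lemma sum_powers_below_le:
  fixes r x :: "'a::linordered_field"
  assumes "0 < r" "r < 1" "0 \<le> x"
  shows "(\<Sum>i | i < m \<and> r ^ i \<le> x. r ^ i) \<le> x / (1 - r)"
  using \<open>0 \<le> x\<close>
proof (induction m arbitrary: x)
  case 0
  then show ?case using \<open>r < 1\<close> by simp
next
  case (Suc m)
  show ?case
  proof (cases "1 \<le> x")
    case True
    have "(\<Sum>i | i < Suc m \<and> r ^ i \<le> x. r ^ i) \<le> (\<Sum>i<Suc m. r ^ i)"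
      using \<open>0 < r\<close> by (intro sum_mono2) auto
    also have "\<dots> = (1 - r ^ Suc m) / (1 - r)"
      using \<open>r < 1\<close> by (simp only: sum_gp_strict) simp
    also have "\<dots> \<le> x / (1 - r)"
    proof (rule divide_right_mono)
      have "0 \<le> r ^ Suc m" using \<open>0 < r\<close> by simp
      then show "1 - r ^ Suc m \<le> x" using True by linarith
    qed (use \<open>r < 1\<close> in simp)
    finally show ?thesis .
  next
    case False
    have "{i. i < Suc m \<and> r ^ i \<le> x} = Suc ` {i. i < m \<and> r ^ i \<le> x / r}" (is "?A = _ ` ?B")
    proof (intro set_eqI)
      fix i
      show "i \<in> ?A \<longleftrightarrow> i \<in> Suc ` ?B"
        using False \<open>0 < r\<close> by (cases i) (auto simp: field_simps)
    qed
    then have "(\<Sum>i\<in>?A. r ^ i) = r * (\<Sum>i\<in>?B. r ^ i)"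
      by (simp add: sum.reindex sum_distrib_left)
    also have "\<dots> \<le> r * (x / r / (1 - r))"
      using Suc.prems \<open>0 < r\<close> by (intro mult_left_mono Suc.IH) auto
    finally show ?thesis using \<open>0 < r\<close> by simp
  qed
qed

lemma of_nat_div_gt: "of_nat m / of_nat n - 1 < (of_nat (m div n) :: 'a::floor_ceiling)"
  using floor_correct[of "of_nat m / of_nat n :: 'a"]
  by (simp add: floor_divide_of_nat_eq algebra_simps)

lemma card_residue_class_ge:
  fixes a k n :: nat
  assumes "a < k"
  shows "n div k \<le> card {s. s < n \<and> s mod k = a}"
proof -
  have "(\<lambda>q. q * k + a) ` {..<n div k} \<subseteq> {s. s < n \<and> s mod k = a}"
  proof clarify
    fix q assume "q < n div k"
    then have "Suc q * k \<le> n"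
      using assms by (simp add: less_eq_div_iff_mult_less_eq Suc_le_eq[symmetric] del: mult_Suc)
    then show "q * k + a < n \<and> (q * k + a) mod k = a"
      using assms by simp
  qed
  moreover have "inj_on (\<lambda>q. q * k + a) {..<n div k}"
    using assms by (auto simp: inj_on_def)
  ultimately have "card {..<n div k} \<le> card {s. s < n \<and> s mod k = a}"
    by (intro card_inj_on_le) auto
  then show ?thesis by simp
qed

lemma card_vimage_div:
  fixes m :: nat
  assumes "0 < m"
  shows "card ((\<lambda>j. j div m) -` S) = m * card S"
proof -
  have "bij_betw (\<lambda>j. (j div m, j mod m)) ((\<lambda>j. j div m) -` S) (S \<times> {..<m})"
    by (rule bij_betw_byWitness[where f' = "\<lambda>(s, t). s * m + t"]) (use assms in auto)
  then have "card ((\<lambda>j. j div m) -` S) = card (S \<times> {..<m})"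
    by (rule bij_betw_same_card)
  then show ?thesis by (simp add: card_cartesian_product)
qed

lemma sum_card_fibres_le:
  assumes "finite A" "finite S"
  shows "(\<Sum>s\<in>S. card {x \<in> A. f x = s}) \<le> card A"
proof -
  have "(\<Sum>s\<in>S. card {x \<in> A. f x = s}) = card (\<Union>s\<in>S. {x \<in> A. f x = s})"
    using assms by (subst card_UN_disjoint) auto
  also have "\<dots> \<le> card A"
    using assms by (intro card_mono) auto
  finally show ?thesis .
qed

section \<open>Connected images\<close>

lemma finite_pixels: "finite (pixels N)"
  by (simp add: pixels_def)

lemma image_edges_iff:
  "((i, j), (i', j')) \<in> image_edges N M \<longleftrightarrow>
     (i, j) \<in> black_pixels N M \<and> (i', j') \<in> black_pixels N M \<and>
     \<bar>int i - int i'\<bar> + \<bar>int j - int j'\<bar> = 1"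
  by (simp add: image_edges_def)

lemma sym_image_edges: "sym (image_edges N M)"
  by (rule symI) (auto simp: image_edges_iff)

lemma image_edges_rtrancl_sym:
  "(p, q) \<in> (image_edges N M)\<^sup>* \<Longrightarrow> (q, p) \<in> (image_edges N M)\<^sup>*"
  using sym_rtrancl[OF sym_image_edges] by (rule symD)

lemma row_path:
  assumes "{r} \<times> {min a b..max a b} \<subseteq> black_pixels N M"
  shows "((r, a), (r, b)) \<in> (image_edges N M)\<^sup>*"
  using assms
proof (induction a b rule: linorder_wlog)
  case (le a b)
  from \<open>a \<le> b\<close> le.prems show ?case
  proof (induction b rule: dec_induct)
    case base
    show ?case by simp
  next
    case (step b)
    then have "((r, b), (r, Suc b)) \<in> image_edges N M"
      by (auto simp: image_edges_iff subset_iff)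
    moreover have "((r, a), (r, b)) \<in> (image_edges N M)\<^sup>*"
      using step by (auto simp: subset_iff)
    ultimately show ?case by (rule rtrancl_into_rtrancl[rotated])
  qed
next
  case (sym b a)
  then have "((r, a), (r, b)) \<in> (image_edges N M)\<^sup>*"
    by (simp add: min.commute max.commute)
  then show ?case by (rule image_edges_rtrancl_sym)
qed

lemma connected_imageI_climb:
  assumes top_row: "\<And>c. c < N \<Longrightarrow> (0, c) \<in> black_pixels N M"
    and climb: "\<And>r c. (Suc r, c) \<in> black_pixels N M \<Longrightarrow>
      \<exists>c'. (r, c') \<in> black_pixels N M \<and> ((Suc r, c), (r, c')) \<in> (image_edges N M)\<^sup>*"
  shows "connected_image N M"
proof -
  have to_corner: "((r, c), (0, 0)) \<in> (image_edges N M)\<^sup>*" if "(r, c) \<in> black_pixels N M" for r c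
    using that
  proof (induction r arbitrary: c)
    case 0
    then have "c < N" by (simp add: black_pixels_def pixels_def)
    then show ?case using top_row by (intro row_path) auto
  next
    case (Suc r)
    then show ?case using climb by (meson rtrancl_trans)
  qed
  then show ?thesis
    unfolding connected_image_def by (metis image_edges_rtrancl_sym rtrancl_trans surj_pair)
qed

text \<open>A region without changed pixels contains a whole component, so a connected image leaves at most
  one region unchanged.\<close>

lemma card_isolated_regions_le:
  assumes "connected_image N M'" "finite T"
    and isolated: "\<And>t. t \<in> T \<Longrightarrow> (\<And>p. p \<in> pixels N \<Longrightarrow> region p = t \<Longrightarrow> M' p = M p) \<Longrightarrow>
      \<exists>S. S \<inter> black_pixels N M' \<noteq> {} \<and> image_edges N M' `` S \<subseteq> S \<and> S \<subseteq> region -` {t}"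
  shows "card T \<le> Suc (card {p \<in> pixels N. M p \<noteq> M' p})"
proof -
  define D where "D = {p \<in> pixels N. M p \<noteq> M' p}"
  have "finite D" by (simp add: D_def finite_pixels)
  have "t = t'" if unchanged: "t \<in> T - region ` D" "t' \<in> T - region ` D" for t t'
  proof -
    have component: "\<exists>S. S \<inter> black_pixels N M' \<noteq> {} \<and> image_edges N M' `` S \<subseteq> S \<and> S \<subseteq> region -` {t}"
      if "t \<in> T - region ` D" for t
      using that by (intro isolated) (auto simp: D_def)
    obtain S p where S: "p \<in> S" "p \<in> black_pixels N M'" "image_edges N M' `` S \<subseteq> S" "S \<subseteq> region -` {t}"
      using component[OF unchanged(1)] by blast
    obtain p' where p': "p' \<in> black_pixels N M'" "region p' = t'"
      using component[OF unchanged(2)] by blast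
    have "(p, p') \<in> (image_edges N M')\<^sup>*"
      using assms(1) S(2) p'(1) by (simp add: connected_image_def)
    then have "p' \<in> S"
      using S(1) Image_closed_trancl[OF S(3)] by blast
    then show "t = t'" using S(4) p'(2) by auto
  qed
  then have "card (T - region ` D) \<le> 1"
    using \<open>finite T\<close> by (simp add: card_le_Suc0_iff_eq)
  moreover have "card (T \<inter> region ` D) \<le> card D"
    using \<open>finite D\<close> by (intro surj_card_le) auto
  moreover have "card T = card (T \<inter> region ` D) + card (T - region ` D)"
    using \<open>finite T\<close> by (rule card_Int_Diff)
  ultimately show ?thesis by (simp add: D_def)
qed

section \<open>Striped images\<close>

definition tile_interior :: "nat \<Rightarrow> nat \<Rightarrow> nat set" where
  "tile_interior w j = {Suc (j * w)..<Suc j * w - 1}"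

lemma tile_interior_neighbour_div:
  assumes "c \<in> tile_interior w j" "\<bar>int c - int c'\<bar> \<le> 1"
  shows "c' div w = j"
  using assms by (intro div_nat_eqI) (auto simp: tile_interior_def mult.commute)

lemma tile_interior_div: "c \<in> tile_interior w j \<Longrightarrow> c div w = j"
  by (rule tile_interior_neighbour_div) auto

lemma card_tile_interior: "card (tile_interior w j) = w - 2"
  by (simp add: tile_interior_def)

text \<open>The tiles are the column blocks of width \<open>w\<close>, and those in \<open>J\<close> carry segments in their even rows.
  A pixel of \<open>G\<close> above a segment connects it to the segment two rows higher; row \<open>0\<close> is black in
  order to connect the topmost segments.\<close>

definition striped_image :: "nat \<Rightarrow> nat \<Rightarrow> nat set \<Rightarrow> pixel set \<Rightarrow> image" where
  "striped_image N w J G =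
     (\<lambda>(r, c) \<in> pixels N. r = 0 \<or> c div w \<notin> J \<or>
        c \<in> tile_interior w (c div w) \<and> (even r \<or> (r, c) \<in> G))"

lemma striped_image_in_images: "striped_image N w J G \<in> images N"
  by (simp add: striped_image_def images_def)

lemma black_pixels_striped_image:
  "(r, c) \<in> black_pixels N (striped_image N w J G) \<longleftrightarrow>
     r < N \<and> c < N \<and>
     (r = 0 \<or> c div w \<notin> J \<or> c \<in> tile_interior w (c div w) \<and> (even r \<or> (r, c) \<in> G))"
  by (auto simp: black_pixels_def pixels_def striped_image_def)

lemma restrict_striped_image:
  assumes "Q \<subseteq> pixels N"
  shows "restrict (striped_image N w J (- Q)) Q = restrict (striped_image N w J {}) Q"
  using assms by (intro restrict_ext) (auto simp: striped_image_def)

lemma connected_striped_image: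
  assumes J: "\<And>j. j \<in> J \<Longrightarrow> Suc j * w \<le> N"
    and gate: "\<And>r j. odd r \<Longrightarrow> j \<in> J \<Longrightarrow> \<exists>d \<in> tile_interior w j. (r, d) \<in> G"
  shows "connected_image N (striped_image N w J G)"
proof (rule connected_imageI_climb)
  let ?M = "striped_image N w J G"
  note black = black_pixels_striped_image
  show "(0, c) \<in> black_pixels N ?M" if "c < N" for c
    using that by (simp add: black)
  fix r c assume pixel_black: "(Suc r, c) \<in> black_pixels N ?M"
  show "\<exists>c'. (r, c') \<in> black_pixels N ?M \<and> ((Suc r, c), (r, c')) \<in> (image_edges N ?M)\<^sup>*"
  proof (cases "(r, c) \<in> black_pixels N ?M")
    case True
    then have "((Suc r, c), (r, c)) \<in> image_edges N ?M"
      using pixel_black by (simp add: image_edges_iff)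
    then show ?thesis using True by blast
  next
    case False
    define j where "j = c div w"
    have below_gate: "Suc r < N" "odd r" "j \<in> J" "c \<in> tile_interior w j"
      using False pixel_black by (auto simp: black j_def)
    obtain d where d: "d \<in> tile_interior w j" "(r, d) \<in> G"
      using gate below_gate by blast
    have "x < N" if "x \<in> tile_interior w j" for x
      using J[OF \<open>j \<in> J\<close>] that by (auto simp: tile_interior_def)
    then have segment_black: "{Suc r} \<times> tile_interior w j \<subseteq> black_pixels N ?M"
      "(r, d) \<in> black_pixels N ?M"
      using below_gate d by (auto simp: black tile_interior_div)
    have "((Suc r, c), (Suc r, d)) \<in> (image_edges N ?M)\<^sup>*"
      using below_gate(4) d(1)
      by (intro row_path order_trans[OF _ segment_black(1)]) (auto simp: tile_interior_def)
    moreover have "((Suc r, d), (r, d)) \<in> image_edges N ?M"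
      using segment_black d(1) by (auto simp: image_edges_iff)
    ultimately show ?thesis using segment_black(2) by (meson rtrancl_into_rtrancl)
  qed
qed

text \<open>Row \<open>4u + 2\<close> lies in the interior of the row block \<open>u\<close> of height \<open>4\<close>, so the region given by a
  row block and a tile encloses a segment together with its neighbours.\<close>

lemma segment_closed_under_image_edges:
  assumes "j \<in> J"
    and unchanged: "\<And>r c. r div 4 = u \<Longrightarrow> c div w = j \<Longrightarrow>
      (r, c) \<in> black_pixels N M' \<longleftrightarrow> (r, c) \<in> black_pixels N (striped_image N w J {})"
  shows "image_edges N M' `` ({4 * u + 2} \<times> tile_interior w j) \<subseteq> {4 * u + 2} \<times> tile_interior w j"
proof clarify
  fix c r' c'
  assume c: "c \<in> tile_interior w j" and edge: "((4 * u + 2, c), (r', c')) \<in> image_edges N M'"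
  have adjacent: "\<bar>int (4 * u + 2) - int r'\<bar> + \<bar>int c - int c'\<bar> = 1"
    using edge by (simp add: image_edges_iff)
  then have row: "r' \<in> {4 * u + 1, 4 * u + 2, 4 * u + 3}" by auto
  have region: "r' div 4 = u" "c' div w = j"
    using adjacent tile_interior_neighbour_div[OF c, of c'] by linarith+
  have "(r', c') \<in> black_pixels N (striped_image N w J {})"
    using edge unchanged[OF region] by (simp add: image_edges_iff)
  then have "even r'" "c' \<in> tile_interior w j"
    using \<open>j \<in> J\<close> row region by (auto simp: black_pixels_striped_image)
  then show "r' \<in> {4 * u + 2} \<and> c' \<in> tile_interior w j" using row by auto
qed

lemma striped_image_distance:
  assumes J: "\<And>j. j \<in> J \<Longrightarrow> Suc j * w \<le> N" and "3 \<le> w" "finite J"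
    and conn: "connected_image N M'"
  shows "N div 4 * card J \<le> Suc (card {p \<in> pixels N. striped_image N w J {} p \<noteq> M' p})"
proof -
  define region where "region = (\<lambda>(r, c). (r div 4, c div w) :: nat \<times> nat)"
  have "card ({..<N div 4} \<times> J) \<le> Suc (card {p \<in> pixels N. striped_image N w J {} p \<noteq> M' p})"
  proof (rule card_isolated_regions_le[OF conn])
    show "finite ({..<N div 4} \<times> J)" using \<open>finite J\<close> by simp
    fix t
    assume "t \<in> {..<N div 4} \<times> J"
      and unchanged: "\<And>p. p \<in> pixels N \<Longrightarrow> region p = t \<Longrightarrow> M' p = striped_image N w J {} p"
    then obtain u j where t: "t = (u, j)" "u < N div 4" "j \<in> J" by auto
    have black: "(r, c) \<in> black_pixels N M' \<longleftrightarrow> (r, c) \<in> black_pixels N (striped_image N w J {})"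
      if "r div 4 = u" "c div w = j" for r c
      using unchanged[of "(r, c)"] that t by (auto simp: black_pixels_def region_def)
    let ?S = "{4 * u + 2} \<times> tile_interior w j"
    have left_end: "Suc (j * w) \<in> tile_interior w j"
      using \<open>3 \<le> w\<close> by (auto simp: tile_interior_def)
    have "(4 * u + 2, Suc (j * w)) \<in> black_pixels N M'"
      using J[OF \<open>j \<in> J\<close>] \<open>3 \<le> w\<close> t(2) left_end tile_interior_div[OF left_end]
      by (subst black) (auto simp: black_pixels_striped_image)
    then have "?S \<inter> black_pixels N M' \<noteq> {}" using left_end by blast
    moreover have "image_edges N M' `` ?S \<subseteq> ?S"
      using \<open>j \<in> J\<close> black by (rule segment_closed_under_image_edges)
    moreover have "?S \<subseteq> region -` {t}"
      by (auto simp: region_def t(1) tile_interior_div)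
    ultimately show "\<exists>S. S \<inter> black_pixels N M' \<noteq> {} \<and> image_edges N M' `` S \<subseteq> S \<and> S \<subseteq> region -` {t}"
      by (intro exI[of _ ?S] conjI)
  qed
  then show ?thesis by (simp add: card_cartesian_product)
qed

section \<open>Hard images\<close>

text \<open>A strip consists of \<open>m\<close> tiles, so \<open>j div m\<close> is the strip of tile \<open>j\<close>, and the strips filled are
  those in the residue class of \<open>a\<close> modulo the same \<open>m\<close>.\<close>

definition filled_tiles :: "nat \<Rightarrow> nat \<Rightarrow> nat \<Rightarrow> nat set" where
  "filled_tiles n m a = (\<lambda>j. j div m) -` {s. s < n \<and> s mod m = a}"

definition hard_image :: "nat \<Rightarrow> nat \<Rightarrow> nat \<Rightarrow> nat \<Rightarrow> image" where
  "hard_image N w m a = striped_image N w (filled_tiles (N div (w * m)) m a) {}"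

lemma hard_image_in_images: "hard_image N w m a \<in> images N"
  by (simp add: hard_image_def striped_image_in_images)

lemma finite_filled_tiles:
  assumes "0 < m"
  shows "finite (filled_tiles n m a)"
  by (rule finite_subset[of _ "{..<n * m}"])
    (use assms in \<open>auto simp: filled_tiles_def div_less_iff_less_mult\<close>)

lemma filled_tiles_bound:
  assumes "0 < m" "j \<in> filled_tiles (N div (w * m)) m a"
  shows "Suc j * w \<le> N"
proof -
  have "j < N div (w * m) * m"
    using assms by (simp add: filled_tiles_def div_less_iff_less_mult)
  then have "Suc j * w \<le> N div (w * m) * m * w"
    by (intro mult_le_mono1) simp
  also have "\<dots> = N div (w * m) * (w * m)" by simp
  also have "\<dots> \<le> N" by (rule div_times_less_eq_dividend)
  finally show ?thesis .
qed

lemma card_filled_tiles_ge: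
  assumes "a < m" "0 < w" "4 * (real (w * m))\<^sup>2 \<le> real N"
  shows "real N / (2 * real (w * m)) \<le> real (card (filled_tiles (N div (w * m)) m a))"
proof -
  define n where "n = N div (w * m)"
  define W where "W = real (w * m)"
  have W: "1 \<le> W" "real m \<le> W"
    using assms(1,2) by (simp_all add: W_def flip: of_nat_mult)
  then have "2 * W \<le> real N / (2 * W)"
    using assms(3)[folded W_def] by (simp add: field_simps power2_eq_square)
  moreover have "real N / W = 2 * (real N / (2 * W))" by simp
  moreover have "real N / W - 1 \<le> real n"
    using of_nat_div_gt[of N "w * m", where 'a = real] by (simp add: n_def W_def)
  ultimately have "real N / (2 * W) \<le> real n - real m"
    using W by linarith
  also have "\<dots> \<le> real (m * (n div m))"
    using mult_div_mod_eq[of m n] mod_less_divisor[of m n] \<open>a < m\<close> by linarith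
  also have "m * (n div m) \<le> card (filled_tiles n m a)"
    using card_residue_class_ge[OF \<open>a < m\<close>] \<open>a < m\<close>
    by (subst filled_tiles_def, subst card_vimage_div) auto
  finally show ?thesis by (simp add: n_def W_def)
qed

lemma hard_image_distance:
  assumes "3 \<le> w" "a < m" "4 * (real (w * m))\<^sup>2 \<le> real N" and conn: "connected_image N M'"
  shows "(real N)\<^sup>2 / (32 * real (w * m)) \<le> real (card {p \<in> pixels N. hard_image N w m a p \<noteq> M' p})"
proof -
  define W where "W = real (w * m)"
  define J where "J = filled_tiles (N div (w * m)) m a"
  define d where "d = card {p \<in> pixels N. hard_image N w m a p \<noteq> M' p}"
  have "3 * 1 \<le> w * m" using assms(1,2) by (intro mult_le_mono) auto
  then have W: "3 \<le> W" by (simp add: W_def flip: of_nat_mult)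
  then have "3 * W \<le> W\<^sup>2" by (simp add: power2_eq_square)
  then have N: "12 * W \<le> real N" "36 \<le> real N"
    using assms(3)[folded W_def] W by linarith+
  have "N div 4 * card J \<le> Suc d"
    unfolding d_def hard_image_def J_def
    using assms(2)
    by (intro striped_image_distance[OF filled_tiles_bound assms(1) finite_filled_tiles conn]) auto
  then have changes: "real (N div 4) * real (card J) \<le> 1 + real d"
    by (simp flip: of_nat_mult)
  have "real N / 8 \<le> real (N div 4)"
    using of_nat_div_gt[of N 4, where 'a = real] N(2) by simp
  then have "real N / 8 * (real N / (2 * W)) \<le> real (N div 4) * real (card J)"
    using card_filled_tiles_ge[OF assms(2) _ assms(3)] assms(1)
    by (intro mult_mono) (auto simp: W_def J_def)
  then have "2 * ((real N)\<^sup>2 / (32 * W)) \<le> 1 + real d"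
    using changes by (simp add: power2_eq_square)
  moreover have "1 \<le> (real N)\<^sup>2 / (32 * W)"
  proof -
    have "36 * (12 * W) \<le> real N * real N" using N W by (intro mult_mono) auto
    then show ?thesis using W by (simp add: power2_eq_square)
  qed
  ultimately show ?thesis unfolding d_def W_def by linarith
qed

lemma hard_image_far:
  assumes "3 \<le> w" "a < m" "4 * (real (w * m))\<^sup>2 \<le> real N" "32 * \<epsilon> * real (w * m) \<le> 1"
  shows "far_from_connected N \<epsilon> (hard_image N w m a)"
  unfolding far_from_connected_def
proof (intro ballI impI)
  fix M' assume conn: "connected_image N M'"
  have "0 < real (w * m)" using assms(1,2) by simp
  then have "\<epsilon> \<le> 1 / (32 * real (w * m))" using assms(4) by (simp add: field_simps)
  from mult_right_mono[OF this, of "(real N)\<^sup>2"]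
  have "\<epsilon> * (real N)\<^sup>2 \<le> (real N)\<^sup>2 / (32 * real (w * m))" by simp
  also note hard_image_distance[OF assms(1-3) conn]
  finally show "\<epsilon> * (real N)\<^sup>2 \<le> real (card {p \<in> pixels N. hard_image N w m a p \<noteq> M' p})" .
qed

section \<open>Refuting connectedness\<close>

definition refutes_connectedness :: "nat \<Rightarrow> pixel set \<Rightarrow> image \<Rightarrow> bool" where
  "refutes_connectedness N Q M \<longleftrightarrow>
     (\<forall>M' \<in> images N. connected_image N M' \<longrightarrow> restrict M' Q \<noteq> restrict M Q)"

lemma refutes_striped_imageE:
  assumes "Q \<subseteq> pixels N" "\<And>j. j \<in> J \<Longrightarrow> Suc j * w \<le> N"
    and "refutes_connectedness N Q (striped_image N w J {})"
  obtains r j where "j \<in> J" "{r} \<times> tile_interior w j \<subseteq> Q"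
proof -
  have "\<not> connected_image N (striped_image N w J (- Q))"
    using assms(3) restrict_striped_image[OF assms(1)] striped_image_in_images
    by (auto simp: refutes_connectedness_def)
  then obtain r j where "j \<in> J" "\<forall>d \<in> tile_interior w j. (r, d) \<in> Q"
    using connected_striped_image[OF assms(2), where G = "- Q"] by blast
  then show thesis by (intro that) auto
qed

definition strip_queries :: "nat \<Rightarrow> pixel set \<Rightarrow> nat \<Rightarrow> pixel set" where
  "strip_queries W Q s = {p \<in> Q. snd p div W = s}"

lemma refutes_hard_imageE:
  assumes "Q \<subseteq> pixels N" "0 < m" "refutes_connectedness N Q (hard_image N w m a)"
  obtains s where "s < N div (w * m)" "s mod m = a" "w - 2 \<le> card (strip_queries (w * m) Q s)"
proof -
  obtain r j where j: "j \<in> filled_tiles (N div (w * m)) m a"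
      and segment: "{r} \<times> tile_interior w j \<subseteq> Q"
    by (rule refutes_striped_imageE
        [OF assms(1) filled_tiles_bound[OF assms(2)] assms(3)[unfolded hard_image_def]])
  have "{r} \<times> tile_interior w j \<subseteq> strip_queries (w * m) Q (j div m)"
    using segment by (auto simp: strip_queries_def div_mult2_eq tile_interior_div)
  moreover have "finite (strip_queries (w * m) Q (j div m))"
    using assms(1) by (intro finite_subset[OF _ finite_pixels]) (auto simp: strip_queries_def)
  ultimately have "card ({r} \<times> tile_interior w j) \<le> card (strip_queries (w * m) Q (j div m))"
    by (rule card_mono[rotated])
  then show thesis
    using j by (intro that[of "j div m"])
      (auto simp: filled_tiles_def card_cartesian_product card_tile_interior)
qed

abbreviation dyadic_hard_image :: "nat \<Rightarrow> nat \<Rightarrow> nat \<Rightarrow> nat \<Rightarrow> image" where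
  "dyadic_hard_image N K i a \<equiv> hard_image N (2 ^ (K - i)) (2 ^ i) a"

lemma dyadic_tile_width:
  assumes "i + 2 \<le> K"
  shows "4 \<le> (2::nat) ^ (K - i)" and "2 ^ (K - i) * 2 ^ i = (2::nat) ^ K"
proof -
  have "2 ^ 2 \<le> (2::nat) ^ (K - i)" using assms by (intro power_increasing) auto
  then show "4 \<le> (2::nat) ^ (K - i)" by simp
  show "2 ^ (K - i) * 2 ^ i = (2::nat) ^ K" using assms by (simp flip: power_add)
qed

lemma card_refuted_dyadic_hard_images_le:
  assumes Q: "Q \<subseteq> pixels N" and "i + 2 \<le> K"
  shows "card {a. a < 2 ^ i \<and> refutes_connectedness N Q (dyadic_hard_image N K i a)}
    \<le> card {s. s < N div 2 ^ K \<and> (1 / 2) ^ i \<le> 2 * real (card (strip_queries (2 ^ K) Q s)) / 2 ^ K}"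
    (is "card ?A \<le> card ?S")
proof (rule surj_card_le)
  show "?A \<subseteq> (\<lambda>s. s mod 2 ^ i) ` ?S"
  proof clarify
    fix a assume "refutes_connectedness N Q (dyadic_hard_image N K i a)"
    then obtain s where s: "s < N div 2 ^ K" "s mod 2 ^ i = a"
      "2 ^ (K - i) - 2 \<le> card (strip_queries (2 ^ K) Q s)"
      using refutes_hard_imageE[OF Q, of "2 ^ i" "2 ^ (K - i)" a]
      by (auto simp: dyadic_tile_width(2)[OF assms(2)])
    have "2 ^ (K - i) \<le> 2 * card (strip_queries (2 ^ K) Q s)"
      using s(3) dyadic_tile_width(1)[OF assms(2)] by simp
    from mult_le_mono1[OF this, of "2 ^ i"]
    have "2 ^ K \<le> 2 * card (strip_queries (2 ^ K) Q s) * 2 ^ i"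
      by (simp only: dyadic_tile_width(2)[OF assms(2)])
    from of_nat_mono[OF this, where 'a = real]
    have "2 ^ K \<le> 2 * real (card (strip_queries (2 ^ K) Q s)) * 2 ^ i" by simp
    then have "(1 / 2) ^ i \<le> 2 * real (card (strip_queries (2 ^ K) Q s)) / 2 ^ K"
      by (simp add: power_one_over field_simps)
    then show "a \<in> (\<lambda>s. s mod 2 ^ i) ` ?S" using s(1,2) by blast
  qed
qed simp

lemma refuted_dyadic_hard_images_weight_le:
  assumes Q: "Q \<subseteq> pixels N"
  shows "(\<Sum>i<K - 1. \<Sum>a | a < 2 ^ i \<and> refutes_connectedness N Q (dyadic_hard_image N K i a). (1 / 2) ^ i)
    \<le> 4 / 2 ^ K * real (card Q)"
proof -
  define n where "n = N div 2 ^ K"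
  define x where "x s = 2 * real (card (strip_queries (2 ^ K) Q s)) / 2 ^ K" for s
  have "(\<Sum>i<K - 1. \<Sum>a | a < 2 ^ i \<and> refutes_connectedness N Q (dyadic_hard_image N K i a). (1 / 2) ^ i)
      \<le> (\<Sum>i<K - 1. \<Sum>s | s < n \<and> (1 / 2) ^ i \<le> x s. (1 / 2 :: real) ^ i)"
  proof (rule sum_mono)
    fix i assume "i \<in> {..<K - 1}"
    then have "i + 2 \<le> K" by auto
    from card_refuted_dyadic_hard_images_le[OF Q this]
    show "(\<Sum>a | a < 2 ^ i \<and> refutes_connectedness N Q (dyadic_hard_image N K i a). (1 / 2) ^ i)
        \<le> (\<Sum>s | s < n \<and> (1 / 2) ^ i \<le> x s. (1 / 2 :: real) ^ i)"
      by (simp add: n_def x_def mult_right_mono)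
  qed
  also have "\<dots> = (\<Sum>s<n. \<Sum>i | i < K - 1 \<and> (1 / 2) ^ i \<le> x s. (1 / 2) ^ i)"
    using sum.swap_restrict[of "{..<K - 1}" "{..<n}" "\<lambda>i s. (1 / 2 :: real) ^ i" "\<lambda>i s. (1 / 2) ^ i \<le> x s"]
    by simp
  also have "\<dots> \<le> (\<Sum>s<n. x s / (1 - 1 / 2))"
    by (intro sum_mono sum_powers_below_le) (auto simp: x_def)
  also have "\<dots> = 4 / 2 ^ K * real (\<Sum>s<n. card (strip_queries (2 ^ K) Q s))"
    by (simp add: x_def sum_distrib_left)
  also have "\<dots> \<le> 4 / 2 ^ K * real (card Q)"
  proof -
    have "(\<Sum>s<n. card (strip_queries (2 ^ K) Q s)) \<le> card Q"
      unfolding strip_queries_def using finite_subset[OF Q finite_pixels]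
      by (intro sum_card_fibres_le) auto
    then show ?thesis by (intro mult_left_mono of_nat_mono) auto
  qed
  finally show ?thesis .
qed

section \<open>Testers\<close>

lemma tester_rejection_refutes:
  assumes "one_sided_nonadaptive_tester N \<epsilon> T" "(Q, D) \<in> set_pmf T" "\<not> D (restrict M Q)"
  shows "refutes_connectedness N Q M"
  unfolding refutes_connectedness_def
proof (intro ballI impI)
  fix M' assume "M' \<in> images N" "connected_image N M'"
  then have "measure_pmf.prob T {(Q, D). D (restrict M' Q)} = 1"
    using assms(1) by (simp add: one_sided_nonadaptive_tester_def accept_prob_def)
  then have "AE x in measure_pmf T. x \<in> {(Q, D). D (restrict M' Q)}"
    by (subst (asm) measure_pmf.prob_eq_1) auto
  then have "D (restrict M' Q)"
    using assms(2) by (auto simp: AE_measure_pmf_iff)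
  then show "restrict M' Q \<noteq> restrict M Q" using assms(3) by auto
qed

lemma tester_refutation_prob_ge:
  assumes "one_sided_nonadaptive_tester N \<epsilon> T" "M \<in> images N" "far_from_connected N \<epsilon> M"
  shows "2 / 3 \<le> measure_pmf.prob T {(Q, D). refutes_connectedness N Q M}"
proof -
  have "2 / 3 \<le> measure_pmf.prob T {(Q, D). \<not> D (restrict M Q)}"
    using assms by (simp add: one_sided_nonadaptive_tester_def reject_prob_def)
  also have "\<dots> \<le> measure_pmf.prob T {(Q, D). refutes_connectedness N Q M}"
    using tester_rejection_refutes[OF assms(1)]
    by (intro measure_pmf.finite_measure_mono_AE) (auto simp: AE_measure_pmf_iff)
  finally show ?thesis .
qed

lemma card_le_query_complexity:
  assumes "queries_within N T" "(Q, D) \<in> set_pmf T"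
  shows "card Q \<le> query_complexity T"
proof -
  have "(\<lambda>(Q, D). card Q) ` set_pmf T \<subseteq> {..card (pixels N)}"
    using assms(1) by (auto simp: queries_within_def intro!: card_mono finite_pixels)
  then have "finite ((\<lambda>(Q, D). card Q) ` set_pmf T)"
    by (rule finite_subset) simp
  then show ?thesis
    unfolding query_complexity_def using assms(2) by (force intro: Max_ge)
qed

text \<open>The easy direction of Yao's principle, with \<open>\<omega>\<close> as an unnormalized distribution on inputs.\<close>

lemma query_complexity_ge_weight:
  fixes \<omega> :: "'i \<Rightarrow> real"
  assumes tester: "one_sided_nonadaptive_tester N \<epsilon> T" and "finite I" "0 \<le> B"
    and images: "\<And>x. x \<in> I \<Longrightarrow> M x \<in> images N"
    and far: "\<And>x. x \<in> I \<Longrightarrow> far_from_connected N \<epsilon> (M x)"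
    and nonneg: "\<And>x. x \<in> I \<Longrightarrow> 0 \<le> \<omega> x"
    and refuted: "\<And>Q. Q \<subseteq> pixels N \<Longrightarrow>
      (\<Sum>x | x \<in> I \<and> refutes_connectedness N Q (M x). \<omega> x) \<le> B * real (card Q)"
  shows "2 / 3 * sum \<omega> I \<le> B * real (query_complexity T)"
proof -
  have within: "queries_within N T"
    using tester by (simp add: one_sided_nonadaptive_tester_def)
  define R :: "'i \<Rightarrow> (pixel set \<times> ((pixel \<Rightarrow> bool) \<Rightarrow> bool)) set"
    where "R x = {(Q, D). refutes_connectedness N Q (M x)}" for x
  have integrable: "integrable (measure_pmf T) (\<lambda>A. \<omega> x * indicator (R x) A)" for x
    by (intro integrable_mult_right measure_pmf.integrable_const_bound[where B = 1])
      (auto simp: indicator_def)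
  have "2 / 3 * sum \<omega> I = (\<Sum>x\<in>I. \<omega> x * (2 / 3))"
    by (simp only: sum_distrib_right mult.commute)
  also have "\<dots> \<le> (\<Sum>x\<in>I. \<omega> x * measure_pmf.prob T (R x))"
    using tester_refutation_prob_ge[OF tester images far] nonneg
    by (intro sum_mono mult_left_mono) (auto simp: R_def)
  also have "\<dots> = measure_pmf.expectation T (\<lambda>A. \<Sum>x\<in>I. \<omega> x * indicator (R x) A)"
    using integrable by (simp add: Bochner_Integration.integral_sum)
  also have "\<dots> \<le> measure_pmf.expectation T (\<lambda>_. B * real (query_complexity T))"
  proof (intro integral_mono_AE)
    have "(\<Sum>x\<in>I. \<omega> x * indicator (R x) (Q, D)) \<le> B * real (query_complexity T)"
      if "(Q, D) \<in> set_pmf T" for Q D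
    proof -
      have "(\<Sum>x\<in>I. \<omega> x * indicator (R x) (Q, D))
          = (\<Sum>x | x \<in> I \<and> refutes_connectedness N Q (M x). \<omega> x)"
        using \<open>finite I\<close> by (intro sum.mono_neutral_cong_right) (auto simp: R_def)
      also have "\<dots> \<le> B * real (card Q)"
        using within that by (intro refuted) (auto simp: queries_within_def)
      also have "\<dots> \<le> B * real (query_complexity T)"
        using card_le_query_complexity[OF within that] \<open>0 \<le> B\<close> by (intro mult_left_mono) auto
      finally show ?thesis .
    qed
    then show "AE A in measure_pmf T. (\<Sum>x\<in>I. \<omega> x * indicator (R x) A) \<le> B * real (query_complexity T)"
      by (auto simp: AE_measure_pmf_iff)
  qed (use integrable in auto)
  finally show ?thesis by simp
qed

lemma query_complexity_dyadic_lower_bound: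
  assumes tester: "one_sided_nonadaptive_tester N \<epsilon> T"
    and "4 * (2 ^ K)\<^sup>2 \<le> N" "32 * \<epsilon> * 2 ^ K \<le> 1"
  shows "real (K - 1) * 2 ^ K \<le> 6 * real (query_complexity T)"
proof -
  let ?I = "SIGMA i:{..<K - 1}. {..<(2::nat) ^ i}"
  let ?M = "\<lambda>(i, a). dyadic_hard_image N K i a"
  let ?\<omega> = "\<lambda>(i, a :: nat). (1 / 2 :: real) ^ i"
  have "2 / 3 * sum ?\<omega> ?I \<le> 4 / 2 ^ K * real (query_complexity T)"
  proof (rule query_complexity_ge_weight[OF tester])
    fix x assume "x \<in> ?I"
    then obtain i a where x: "x = (i, a)" "i + 2 \<le> K" "a < 2 ^ i" by auto
    have "4 * (real (2 ^ (K - i) * 2 ^ i))\<^sup>2 \<le> real N"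
      using of_nat_mono[OF assms(2), where 'a = real] by (simp add: dyadic_tile_width(2)[OF x(2)])
    moreover have "32 * \<epsilon> * real (2 ^ (K - i) * 2 ^ i) \<le> 1"
      using assms(3) by (simp add: dyadic_tile_width(2)[OF x(2)])
    ultimately have "far_from_connected N \<epsilon> (dyadic_hard_image N K i a)"
      using dyadic_tile_width(1)[OF x(2)] x(3) by (intro hard_image_far) auto
    then show "far_from_connected N \<epsilon> (?M x)" by (simp add: x(1))
  next
    fix Q assume Q: "Q \<subseteq> pixels N"
    have "{x. x \<in> ?I \<and> refutes_connectedness N Q (?M x)}
        = (SIGMA i:{..<K - 1}. {a. a < 2 ^ i \<and> refutes_connectedness N Q (dyadic_hard_image N K i a)})"
      by auto
    then show "(\<Sum>x | x \<in> ?I \<and> refutes_connectedness N Q (?M x). ?\<omega> x) \<le> 4 / 2 ^ K * real (card Q)"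
      using refuted_dyadic_hard_images_weight_le[OF Q, of K] by (simp add: sum.Sigma[symmetric])
  qed (auto simp: hard_image_in_images)
  moreover have "sum ?\<omega> ?I = real (K - 1)"
    by (simp add: sum.Sigma[symmetric] power_one_over)
  ultimately show ?thesis by (simp add: field_simps)
qed

lemma dyadic_scaleE:
  fixes x :: real
  assumes "0 < x" "x \<le> 1"
  obtains K where "x * 2 ^ K \<le> 1" "1 < x * 2 ^ (K + 1)"
proof -
  obtain n where "1 / x < 2 ^ n" using real_arch_pow[of 2] by auto
  then have "1 < x * 2 ^ n" using assms(1) by (simp add: field_simps)
  moreover have "\<not> 1 < x * 2 ^ 0" using assms(2) by simp
  ultimately obtain K where "\<forall>i\<le>K. \<not> 1 < x * 2 ^ i" "1 < x * 2 ^ Suc K"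
    using ex_least_nat_less[of "\<lambda>n. 1 < x * 2 ^ n" n] by blast
  then show thesis by (intro that[of K]) (auto simp: not_less)
qed

lemma inverse_ln_le_dyadic_scale:
  fixes \<epsilon> :: real
  assumes "0 < \<epsilon>" "\<epsilon> \<le> 1 / 2 ^ 13" "1 < 32 * \<epsilon> * 2 ^ (K + 1)"
  shows "1 / \<epsilon> * ln (1 / \<epsilon>) \<le> 128 * (real (K - 1) * 2 ^ K)"
proof -
  have inverse_less: "1 / \<epsilon> < 2 ^ (K + 6)"
    using assms(1,3) by (simp add: power_add field_simps)
  have "(2::real) ^ 13 \<le> 1 / \<epsilon>" using assms(1,2) by (simp add: field_simps)
  also note inverse_less
  finally have "13 < K + 6" by (rule power_less_imp_less_exp[rotated]) simp
  have "ln (1 / \<epsilon>) \<le> ln (2 ^ (K + 6))"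
    using inverse_less assms(1) by (subst ln_le_cancel_iff) auto
  also have "\<dots> = real (K + 6) * ln 2" by (simp add: ln_realpow)
  also have "\<dots> \<le> real (K + 6) * 1" using ln_2_less_1 by (intro mult_left_mono) auto
  also have "\<dots> \<le> 2 * real (K - 1)" using \<open>13 < K + 6\<close> by (simp add: of_nat_diff)
  finally have "1 / \<epsilon> * ln (1 / \<epsilon>) \<le> 2 ^ (K + 6) * (2 * real (K - 1))"
    using inverse_less assms(1,2) by (intro mult_mono) auto
  then show ?thesis by (simp add: power_add mult_ac)
qed

theorem theorem1p2:
  "\<exists>c > (0::real). \<exists>\<epsilon>\<^sub>0 > (0::real). \<forall>\<epsilon>. 0 < \<epsilon> \<and> \<epsilon> \<le> \<epsilon>\<^sub>0 \<longrightarrow>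
     (\<exists>N\<^sub>0. \<forall>N \<ge> N\<^sub>0. \<forall>T. one_sided_nonadaptive_tester N \<epsilon> T \<longrightarrow>
        real (query_complexity T) \<ge> c * (1 / \<epsilon> * ln (1 / \<epsilon>)))"
proof -
  have "\<exists>N\<^sub>0. \<forall>N \<ge> N\<^sub>0. \<forall>T. one_sided_nonadaptive_tester N \<epsilon> T \<longrightarrow>
      real (query_complexity T) \<ge> 1 / 768 * (1 / \<epsilon> * ln (1 / \<epsilon>))"
    if \<epsilon>: "0 < \<epsilon>" "\<epsilon> \<le> 1 / 2 ^ 13" for \<epsilon>
  proof -
    have "0 < 32 * \<epsilon>" "32 * \<epsilon> \<le> 1" using \<epsilon> by simp_all
    then obtain K where K: "32 * \<epsilon> * 2 ^ K \<le> 1" "1 < 32 * \<epsilon> * 2 ^ (K + 1)"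
      by (rule dyadic_scaleE)
    show ?thesis
    proof (intro exI[of _ "4 * (2 ^ K)\<^sup>2"] allI impI)
      fix N T assume "4 * (2 ^ K)\<^sup>2 \<le> N" "one_sided_nonadaptive_tester N \<epsilon> T"
      then have "real (K - 1) * 2 ^ K \<le> 6 * real (query_complexity T)"
        using K(1) by (intro query_complexity_dyadic_lower_bound)
      then show "real (query_complexity T) \<ge> 1 / 768 * (1 / \<epsilon> * ln (1 / \<epsilon>))"
        using inverse_ln_le_dyadic_scale[OF \<epsilon> K(2)] by linarith
    qed
  qed
  then show ?thesis
    by (intro exI[of _ "1 / 768"] conjI exI[of _ "1 / 2 ^ 13"]) auto
qed

end
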